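(* Consider a system of three robots in the plane with initial positions $R=(r_0,r_1,r_2)$ in general position (not collinear, and with no symmetry, so that the three distances between them are pairwise distinct), and a pattern $P=(p_0,p_1,p_2)$, and suppose $d(r_0,r_1)\le d(r_1,r_2)\le d(r_2,r_0)$. Then $P$ is an optimal assignment for $R$ if and only if $d(p_0,p_1)\le d(p_1,p_2)\le d(p_2,p_0)$.
   Context: $d(\cdot,\cdot)$ is Euclidean distance. A pattern is a sequence of distinct points in the plane. An assignment is a permutation of the pattern: under the assignment $P=(p_0,p_1,p_2)$, robot $i$ takes the role of $p_i$. The cost of the assignment $P$ is the infimum of $\max_i d(r_i,q_i)$ over all $Q=(q_0,q_1,q_2)$ obtained from $P$ by a translation, rotation, uniform scaling, and/or reflection, with indices preserved. $P$ is an optimal assignment for $R$ if its cost is minimum among the costs of all $3!$ permutations of $P$. *)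

theory Defs
  imports "HOL-Analysis.Analysis" "HOL-Combinatorics.Permutations"
begin

text \<open>The plane is \<^typ>\<open>complex\<close>. A triple of points is a function on \<^typ>\<open>nat\<close>
  of which only the values at 0, 1, 2 matter.\<close>

inductive_set plane_similarities :: "(complex \<Rightarrow> complex) set" where
  translation: "(\<lambda>z. z + t) \<in> plane_similarities"
| rotation: "(\<lambda>z. c + cis \<theta> * (z - c)) \<in> plane_similarities"
| scaling: "k > 0 \<Longrightarrow> (\<lambda>z. c + complex_of_real k * (z - c)) \<in> plane_similarities"
| reflection: \<comment> \<open>in the line through \<open>c\<close> with direction \<open>cis \<theta>\<close>\<close>
    "(\<lambda>z. c + cis (2 * \<theta>) * cnj (z - c)) \<in> plane_similarities"
| composition: "f \<in> plane_similarities \<Longrightarrow> g \<in> plane_similarities \<Longrightarrow> f \<circ> g \<in> plane_similarities"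

definition cost :: "(nat \<Rightarrow> complex) \<Rightarrow> (nat \<Rightarrow> complex) \<Rightarrow> real" where
  "cost R P = (INF f\<in>plane_similarities. MAX i\<in>{..<3}. dist (R i) (f (P i)))"

definition optimal_assignment :: "(nat \<Rightarrow> complex) \<Rightarrow> (nat \<Rightarrow> complex) \<Rightarrow> bool" where
  "optimal_assignment R P \<longleftrightarrow> (\<forall>\<sigma>. \<sigma> permutes {..<3} \<longrightarrow> cost R P \<le> cost R (P \<circ> \<sigma>))"

text \<open>A non-collinear triple has a symmetry exactly when two of its three distances agree.\<close>

definition general_position :: "(nat \<Rightarrow> complex) \<Rightarrow> bool" where
  "general_position R \<longleftrightarrow>
     \<not> collinear {R 0, R 1, R 2} \<and>
     distinct [dist (R 0) (R 1), dist (R 1) (R 2), dist (R 2) (R 0)]"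

end

theory Submission
  imports Defs
begin

text \<open>Up to closure, the images of \<open>P\<close> under orientation preserving similarities form the
  complex subspace of \<open>\<complex>\<^sup>3\<close> spanned by \<open>P\<close> and \<open>(1, 1, 1)\<close>. Its annihilator is spanned by the
  edge vector \<open>(p\<^sub>1 - p\<^sub>2, p\<^sub>2 - p\<^sub>0, p\<^sub>0 - p\<^sub>1)\<close>, so by \<open>\<ell>\<^sup>1\<close>-\<open>\<ell>\<^sup>\<infinity>\<close> duality the distance of \<open>R\<close> from
  it is \<open>\<bar>D\<bar>\<close> divided by the perimeter of \<open>P\<close>, where \<open>D\<close> pairs \<open>R\<close> with that vector.
  Reflections replace \<open>P\<close> by its conjugate. Expressing \<open>\<bar>D\<bar>\<^sup>2\<close> through the squared side lengths
  \<open>a, b, c\<close> of \<open>R\<close> and \<open>x, y, z\<close> of \<open>P\<close>, everything except \<open>- (a x + b y + c z)\<close> is invariant under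
  permutations of \<open>P\<close>, and the rearrangement inequality decides the minimum.\<close>

definition edge_pairing :: "(nat \<Rightarrow> complex) \<Rightarrow> (nat \<Rightarrow> complex) \<Rightarrow> complex" where
  "edge_pairing R P = R 0 * (P 1 - P 2) + R 1 * (P 2 - P 0) + R 2 * (P 0 - P 1)"

definition perimeter :: "(nat \<Rightarrow> complex) \<Rightarrow> real" where
  "perimeter P = dist (P 0) (P 1) + dist (P 1) (P 2) + dist (P 2) (P 0)"

text \<open>The absolute value absorbs the orientation, which odd permutations of the points
  reverse.\<close>

definition double_area :: "(nat \<Rightarrow> complex) \<Rightarrow> real" where
  "double_area P = \<bar>Im ((P 1 - P 0) * cnj (P 2 - P 0))\<bar>"

definition side_correlation :: "(nat \<Rightarrow> complex) \<Rightarrow> (nat \<Rightarrow> complex) \<Rightarrow> real" where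
  "side_correlation R P =
     (dist (R 0) (R 1))\<^sup>2 * (dist (P 0) (P 1))\<^sup>2 + (dist (R 1) (R 2))\<^sup>2 * (dist (P 1) (P 2))\<^sup>2
     + (dist (R 2) (R 0))\<^sup>2 * (dist (P 2) (P 0))\<^sup>2"

definition side_squares :: "(nat \<Rightarrow> complex) \<Rightarrow> real" where
  "side_squares P = (dist (P 0) (P 1))\<^sup>2 + (dist (P 1) (P 2))\<^sup>2 + (dist (P 2) (P 0))\<^sup>2"

lemma lessThan_3_nat: "{..<3::nat} = {0, 1, 2}"
  by auto

section \<open>Plane similarities\<close>

text \<open>With the two converses below, this turns the infimum over similarities into one over the
  coefficients \<open>a\<close> and \<open>b\<close>.\<close>

lemma similarity_affine:
  assumes "f \<in> plane_similarities"
  shows "\<exists>a b. a \<noteq> 0 \<and> (f = (\<lambda>z. a * z + b) \<or> f = (\<lambda>z. a * cnj z + b))"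
  using assms
proof induction
  case (translation t)
  show ?case by (intro exI[of _ 1] exI[of _ t]) simp
next
  case (rotation c \<theta>)
  show ?case
    by (intro exI[of _ "cis \<theta>"] exI[of _ "c - cis \<theta> * c"]) (simp add: algebra_simps)
next
  case (scaling k c)
  then show ?case
    by (intro exI[of _ "complex_of_real k"] exI[of _ "c - complex_of_real k * c"])
       (simp add: algebra_simps)
next
  case (reflection c \<theta>)
  show ?case
    by (intro exI[of _ "cis (2 * \<theta>)"] exI[of _ "c - cis (2 * \<theta>) * cnj c"])
       (simp add: algebra_simps)
next
  case (composition f g)
  then obtain a b a' b' where f: "a \<noteq> 0" "f = (\<lambda>z. a * z + b) \<or> f = (\<lambda>z. a * cnj z + b)"
    and g: "a' \<noteq> 0" "g = (\<lambda>z. a' * z + b') \<or> g = (\<lambda>z. a' * cnj z + b')"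
    by metis
  from f(2) show ?case
  proof
    assume "f = (\<lambda>z. a * z + b)"
    with f(1) g show ?thesis
      by (intro exI[of _ "a * a'"] exI[of _ "a * b' + b"]) (auto simp: o_def algebra_simps)
  next
    assume "f = (\<lambda>z. a * cnj z + b)"
    with f(1) g show ?thesis
      by (intro exI[of _ "a * cnj a'"] exI[of _ "a * cnj b' + b"]) (auto simp: o_def algebra_simps)
  qed
qed

text \<open>Polar form of \<open>a\<close>: a scaling by \<open>cmod a\<close> and a rotation by
  \<open>Arg a\<close>, both about 0, then a translation by \<open>b\<close>.\<close>

lemma affine_similarity:
  assumes "a \<noteq> 0"
  shows "(\<lambda>z. a * z + b) \<in> plane_similarities"
proof -
  have a: "cis (Arg a) * complex_of_real (cmod a) = a"
    using rcis_cmod_Arg[of a] by (simp add: rcis_def mult.commute)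
  have "(\<lambda>z. z + b) \<circ> ((\<lambda>z. 0 + cis (Arg a) * (z - 0))
      \<circ> (\<lambda>z. 0 + complex_of_real (cmod a) * (z - 0))) \<in> plane_similarities"
    using assms by (intro plane_similarities.intros) simp
  also have "(\<lambda>z. z + b) \<circ> ((\<lambda>z. 0 + cis (Arg a) * (z - 0))
      \<circ> (\<lambda>z. 0 + complex_of_real (cmod a) * (z - 0))) = (\<lambda>z. a * z + b)"
    using a by (simp add: o_def flip: mult.assoc)
  finally show ?thesis .
qed

lemma affine_cnj_similarity:
  assumes "a \<noteq> 0"
  shows "(\<lambda>z. a * cnj z + b) \<in> plane_similarities"
proof -
  have "(\<lambda>z. a * z + b) \<circ> (\<lambda>z. 0 + cis (2 * 0) * cnj (z - 0)) \<in> plane_similarities"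
    by (intro plane_similarities.composition affine_similarity assms plane_similarities.reflection)
  then show ?thesis by (simp add: o_def)
qed

section \<open>The cost of an assignment\<close>

lemma perimeter_pos: "P 0 \<noteq> P 1 \<Longrightarrow> perimeter P > 0"
  unfolding perimeter_def by (intro add_pos_nonneg) auto

lemma perimeter_cnj: "perimeter (cnj \<circ> P) = perimeter P"
  unfolding perimeter_def dist_norm o_def by (simp flip: complex_cnj_diff)

text \<open>The easy half of the duality: the pairing annihilates \<open>P\<close> and constants, so
  \<open>R\<close> may be replaced by its error vector, whose entries are bounded one by
  one.\<close>

lemma edge_pairing_le:
  assumes "\<And>i. i < 3 \<Longrightarrow> cmod (R i - (a * P i + b)) \<le> M"
  shows "cmod (edge_pairing R P) \<le> perimeter P * M"
proof -
  define E where "E i = R i - (a * P i + b)" for i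
  have E: "cmod (E i) \<le> M" if "i < 3" for i
    using assms that by (simp add: E_def)
  have "edge_pairing R P = E 0 * (P 1 - P 2) + E 1 * (P 2 - P 0) + E 2 * (P 0 - P 1)"
    unfolding edge_pairing_def E_def by algebra
  also have "cmod \<dots> \<le> cmod (E 0) * cmod (P 1 - P 2) + cmod (E 1) * cmod (P 2 - P 0)
      + cmod (E 2) * cmod (P 0 - P 1)"
    by (intro norm_triangle_le add_mono) (simp_all add: norm_mult)
  also have "\<dots> \<le> M * cmod (P 1 - P 2) + M * cmod (P 2 - P 0) + M * cmod (P 0 - P 1)"
    by (intro add_mono mult_right_mono E) auto
  finally show ?thesis
    by (simp add: perimeter_def dist_norm algebra_simps)
qed

text \<open>The error vector is the dual extremal one: all errors have equal modulus and are aligned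
  with the conjugate edge vectors. The slope obtained may be 0, which no similarity has.\<close>

lemma affine_fit:
  assumes "P 0 \<noteq> P 1"
  obtains a b where
    "\<And>i. i < 3 \<Longrightarrow> cmod (R i - (a * P i + b)) \<le> cmod (edge_pairing R P) / perimeter P"
proof -
  \<comment> \<open>This \<open>k\<close> makes the correction \<open>k * cnj (sgn (l i))\<close> of
    each \<open>R i\<close> cancel the whole pairing, since the \<open>cmod (l i)\<close> add up to
    the perimeter.\<close>
  define k where "k = edge_pairing R P / of_real (perimeter P)"
  define l where "l i = (if i = 0 then P 1 - P 2 else if i = 1 then P 2 - P 0 else P 0 - P 1)"
    for i :: nat
  define W where "W i = R i - k * cnj (sgn (l i))" for i
  have sgn: "cnj (sgn z) * z = of_real (cmod z)" for z
    using complex_norm_square[of z]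
    by (cases "z = 0") (simp_all add: sgn_eq power2_eq_square field_simps)
  have "edge_pairing W P = edge_pairing R P
      - k * (cnj (sgn (l 0)) * l 0 + cnj (sgn (l 1)) * l 1 + cnj (sgn (l 2)) * l 2)"
    by (simp add: edge_pairing_def W_def l_def algebra_simps)
  also have "\<dots> = edge_pairing R P - k * of_real (perimeter P)"
    unfolding sgn by (simp add: perimeter_def l_def dist_norm add_ac)
  also have "\<dots> = 0"
    using perimeter_pos[OF assms] by (simp add: k_def)
  \<comment> \<open>A vanishing pairing means that \<open>W\<close> and \<open>P\<close> have
    proportional edges, so the slope read off from one edge fits the other as well.\<close>
  finally have W: "(W 1 - W 0) * (P 2 - P 0) = (W 2 - W 0) * (P 1 - P 0)"
    unfolding edge_pairing_def by algebra
  define a where "a = (W 1 - W 0) / (P 1 - P 0)"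
  define b where "b = W 0 - a * P 0"
  have slope: "a * (P 1 - P 0) = W 1 - W 0"
    using assms by (simp add: a_def)
  with W have "(P 1 - P 0) * (a * (P 2 - P 0)) = (P 1 - P 0) * (W 2 - W 0)"
    by algebra
  then have "a * (P 2 - P 0) = W 2 - W 0"
    using assms by auto
  with slope have "W 0 = a * P 0 + b" "W 1 = a * P 1 + b" "W 2 = a * P 2 + b"
    by (simp_all add: b_def algebra_simps)
  then have fit: "W i = a * P i + b" if "i < 3" for i
    using that by (auto simp: less_Suc_eq numeral_3_eq_3 numeral_2_eq_2)
  have "cmod (R i - (a * P i + b)) \<le> cmod (edge_pairing R P) / perimeter P" if "i < 3" for i
  proof -
    have "cmod (R i - (a * P i + b)) = cmod k * cmod (sgn (l i))"
      unfolding fit[OF that, symmetric] W_def by (simp add: norm_mult)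
    \<comment> \<open>Equality can fail: \<open>P 2\<close> may coincide with \<open>P 0\<close> or
      \<open>P 1\<close>, and then some \<open>sgn (l i)\<close> is 0.\<close>
    also have "\<dots> \<le> cmod k"
      by (simp add: norm_sgn)
    also have "cmod k = cmod (edge_pairing R P) / perimeter P"
      using perimeter_pos[OF assms] by (simp add: k_def norm_divide)
    finally show ?thesis .
  qed
  then show thesis by (rule that)
qed

text \<open>A slope 0 is replaced by a nonzero one so small that no image point moves by more than
  \<open>\<epsilon>\<close>. The bound is then approached rather than attained, which is enough for
  an infimum.\<close>

lemma similarity_fit:
  assumes "P 0 \<noteq> P 1" and "\<epsilon> > 0"
  obtains a b where "a \<noteq> 0"
    "\<And>i. i < 3 \<Longrightarrow> cmod (R i - (a * P i + b)) \<le> cmod (edge_pairing R P) / perimeter P + \<epsilon>"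
proof -
  obtain a b where ab:
    "\<And>i. i < 3 \<Longrightarrow> cmod (R i - (a * P i + b)) \<le> cmod (edge_pairing R P) / perimeter P"
    using affine_fit[OF assms(1)] by blast
  define s where "s = 1 + cmod (P 0) + cmod (P 1) + cmod (P 2)"
  have Ps: "cmod (P i) \<le> s" if "i < 3" for i
    using that by (auto simp: s_def less_Suc_eq numeral_3_eq_3 numeral_2_eq_2)
  have s: "s > 0"
    unfolding s_def by (intro add_pos_nonneg) auto
  define a' where "a' = (if a = 0 then of_real (\<epsilon> / s) else a)"
  have a': "cmod (a - a') \<le> \<epsilon> / s"
    using assms(2) s by (simp add: a'_def norm_divide)
  show thesis
  proof (rule that)
    show "a' \<noteq> 0"
      using assms(2) s by (simp add: a'_def)
    fix i :: nat assume i: "i < 3"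
    have "cmod ((a - a') * P i) \<le> \<epsilon> / s * s"
      unfolding norm_mult using a' Ps[OF i] assms(2) s by (intro mult_mono) auto
    note bounds = ab[OF i] this
    have "R i - (a' * P i + b) = (R i - (a * P i + b)) + (a - a') * P i"
      by algebra
    also have "cmod \<dots> \<le> cmod (edge_pairing R P) / perimeter P + \<epsilon> / s * s"
      by (intro norm_triangle_le add_mono bounds)
    finally show "cmod (R i - (a' * P i + b)) \<le> cmod (edge_pairing R P) / perimeter P + \<epsilon>"
      using s by simp
  qed
qed

lemma cost_le:
  assumes "f \<in> plane_similarities" and "\<And>i. i < 3 \<Longrightarrow> dist (R i) (f (P i)) \<le> M"
  shows "cost R P \<le> M"
proof -
  have "bdd_below ((\<lambda>f. MAX i\<in>{..<3}. dist (R i) (f (P i))) ` plane_similarities)"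
    by (intro bdd_belowI2[of _ 0]) (simp add: lessThan_3_nat le_max_iff_disj)
  then have "cost R P \<le> (MAX i\<in>{..<3}. dist (R i) (f (P i)))"
    unfolding cost_def using assms(1) by (rule cINF_lower)
  also have "\<dots> \<le> M"
    using assms(2) by (subst Max_le_iff) (auto simp: lessThan_3_nat)
  finally show ?thesis .
qed

lemma cost_ge:
  assumes "\<And>f. f \<in> plane_similarities \<Longrightarrow>
    m \<le> (MAX i\<in>{..<3}. dist (R i) (f (P i)))"
  shows "m \<le> cost R P"
  unfolding cost_def using assms plane_similarities.translation by (intro cINF_greatest) auto

text \<open>Orientation reversing similarities of \<open>P\<close> are the orientation preserving
  ones of its mirror image \<open>cnj \<circ> P\<close>, which has the same perimeter. The infimum
  is thus the smaller of two distances given by duality.\<close>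

lemma cost_eq:
  assumes "P 0 \<noteq> P 1"
  shows "cost R P =
    min (cmod (edge_pairing R P)) (cmod (edge_pairing R (cnj \<circ> P))) / perimeter P"
proof (rule antisym)
  note pos = perimeter_pos[OF assms]
  have "cost R P \<le> cmod (edge_pairing R P) / perimeter P"
  proof (rule field_le_epsilon)
    fix \<epsilon> :: real assume "\<epsilon> > 0"
    then obtain a b where "a \<noteq> 0" and
      "\<And>i. i < 3 \<Longrightarrow> cmod (R i - (a * P i + b)) \<le> cmod (edge_pairing R P) / perimeter P + \<epsilon>"
      using similarity_fit[OF assms] by blast
    then show "cost R P \<le> cmod (edge_pairing R P) / perimeter P + \<epsilon>"
      by (intro cost_le[OF affine_similarity[of a b]]) (auto simp: dist_norm)
  qed
  moreover have "cost R P \<le> cmod (edge_pairing R (cnj \<circ> P)) / perimeter P"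
  proof (rule field_le_epsilon)
    fix \<epsilon> :: real assume "\<epsilon> > 0"
    moreover have "(cnj \<circ> P) 0 \<noteq> (cnj \<circ> P) 1"
      using assms by simp
    ultimately obtain a b where "a \<noteq> 0" and "\<And>i. i < 3 \<Longrightarrow> cmod (R i - (a * (cnj \<circ> P) i + b))
        \<le> cmod (edge_pairing R (cnj \<circ> P)) / perimeter (cnj \<circ> P) + \<epsilon>"
      using similarity_fit by blast
    then show "cost R P \<le> cmod (edge_pairing R (cnj \<circ> P)) / perimeter P + \<epsilon>"
      by (intro cost_le[OF affine_cnj_similarity[of a b]]) (auto simp: dist_norm perimeter_cnj)
  qed
  ultimately show "cost R P \<le>
      min (cmod (edge_pairing R P)) (cmod (edge_pairing R (cnj \<circ> P))) / perimeter P"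
    by (simp add: min_def)
  show "min (cmod (edge_pairing R P)) (cmod (edge_pairing R (cnj \<circ> P))) / perimeter P \<le> cost R P"
  proof (rule cost_ge)
    fix f assume "f \<in> plane_similarities"
    then obtain a b where f: "f = (\<lambda>z. a * z + b) \<or> f = (\<lambda>z. a * cnj z + b)"
      using similarity_affine by blast
    define M where "M = (MAX i\<in>{..<3}. dist (R i) (f (P i)))"
    have M: "cmod (R i - f (P i)) \<le> M" if "i < 3" for i
      unfolding M_def dist_norm using that by (intro Max_ge) auto
    from f have "cmod (edge_pairing R P) \<le> perimeter P * M
        \<or> cmod (edge_pairing R (cnj \<circ> P)) \<le> perimeter (cnj \<circ> P) * M"
      using M edge_pairing_le[of R a P b M] edge_pairing_le[of R a "cnj \<circ> P" b M] by auto
    then show "min (cmod (edge_pairing R P)) (cmod (edge_pairing R (cnj \<circ> P))) / perimeter P \<le> M"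
      using pos by (auto simp: perimeter_cnj field_simps)
  qed
qed

section \<open>Squared costs in terms of side lengths and areas\<close>

lemma cmod_edge_pairing_sq:
  "(cmod (edge_pairing R P))\<^sup>2 = side_squares R * side_squares P / 2 - side_correlation R P
     - 2 * (Im ((R 1 - R 0) * cnj (R 2 - R 0)) * Im ((P 1 - P 0) * cnj (P 2 - P 0)))"
proof -
  define u v where "u = R 1 - R 0" and "v = R 2 - R 0"
  define p q where "p = P 1 - P 0" and "q = P 2 - P 0"
  have R: "R 1 = R 0 + u" "R 2 = R 0 + v" and P: "P 1 = P 0 + p" "P 2 = P 0 + q"
    by (simp_all add: u_def v_def p_def q_def)
  have pairing: "edge_pairing R P = u * q - v * p"
    unfolding edge_pairing_def R P by algebra
  \<comment> \<open>The mixed term of the expansion is -2 times \<open>Re (u * cnj v) * Re (p * cnj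
    q) + Im (u * cnj v) * Im (p * cnj q)\<close>. The law of cosines expresses the real parts by
    squared sides.\<close>
  show ?thesis
    unfolding pairing side_squares_def side_correlation_def dist_norm R P cmod_power2
    by (simp add: power2_eq_square field_simps)
qed

text \<open>Conjugating \<open>P\<close> keeps its sides and flips the sign of its oriented area, so
  the smaller squared pairing is the one that subtracts the absolute value of the area
  product.\<close>

lemma cost_sq:
  assumes "P 0 \<noteq> P 1"
  shows "(cost R P * perimeter P)\<^sup>2 = side_squares R * side_squares P / 2
    - side_correlation R P - 2 * (double_area R * double_area P)"
proof -
  define F where "F = side_squares R * side_squares P / 2 - side_correlation R P"
  define t where "t = Im ((R 1 - R 0) * cnj (R 2 - R 0)) * Im ((P 1 - P 0) * cnj (P 2 - P 0))"
  have min_sq: "(min u v)\<^sup>2 = min (u\<^sup>2) (v\<^sup>2)" if "u \<ge> 0" "v \<ge> 0" for u v :: real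
    using that by (auto simp: min_def power_mono intro: antisym)
  have dist_cnj: "dist (cnj u) (cnj v) = dist u v" for u v
    by (simp add: dist_norm flip: complex_cnj_diff)
  have "(cmod (edge_pairing R P))\<^sup>2 = F - 2 * t"
    unfolding F_def t_def by (rule cmod_edge_pairing_sq)
  moreover have "(cmod (edge_pairing R (cnj \<circ> P)))\<^sup>2 = F + 2 * t"
    unfolding cmod_edge_pairing_sq F_def t_def side_squares_def side_correlation_def o_def dist_cnj
    by (simp add: algebra_simps)
  moreover have "double_area R * double_area P = \<bar>t\<bar>"
    unfolding double_area_def t_def abs_mult ..
  ultimately show ?thesis
    using perimeter_pos[OF assms]
    by (simp add: cost_eq[OF assms] min_sq flip: F_def)
qed

text \<open>Multiplying by the common perimeter and squaring keep the order of nonnegative costs. In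
  \<open>cost_sq\<close> only the correlation then differs, and it enters with a minus sign.\<close>

lemma cost_le_iff:
  assumes "inj_on P {..<3}" and "inj_on Q {..<3}" and "perimeter P = perimeter Q"
    and "side_squares P = side_squares Q" and "double_area P = double_area Q"
  shows "cost R P \<le> cost R Q \<longleftrightarrow> side_correlation R Q \<le> side_correlation R P"
proof -
  have PQ: "P 0 \<noteq> P 1" "Q 0 \<noteq> Q 1"
    using inj_onD[OF assms(1), of 0 1] inj_onD[OF assms(2), of 0 1] by auto
  have pos: "perimeter P > 0"
    by (rule perimeter_pos[OF PQ(1)])
  have nonneg: "0 \<le> cost R S" for S
    by (rule cost_ge) (simp add: lessThan_3_nat le_max_iff_disj)
  have "cost R P \<le> cost R Q \<longleftrightarrow> cost R P * perimeter P \<le> cost R Q * perimeter Q"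
    using pos assms(3) by simp
  also have "\<dots> \<longleftrightarrow> (cost R P * perimeter P)\<^sup>2 \<le> (cost R Q * perimeter Q)\<^sup>2"
    using pos nonneg assms(3) by (intro power_mono_iff[symmetric]) auto
  finally show ?thesis
    unfolding cost_sq[OF PQ(1)] cost_sq[OF PQ(2)] using assms(4,5) by simp
qed

section \<open>Rearrangement\<close>

lemma permutes_3_cases:
  assumes "\<sigma> permutes {..<3::nat}"
  obtains "\<sigma> 0 = 0" "\<sigma> 1 = 1" "\<sigma> 2 = 2" | "\<sigma> 0 = 0" "\<sigma> 1 = 2" "\<sigma> 2 = 1"
    | "\<sigma> 0 = 1" "\<sigma> 1 = 0" "\<sigma> 2 = 2" | "\<sigma> 0 = 1" "\<sigma> 1 = 2" "\<sigma> 2 = 0"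
    | "\<sigma> 0 = 2" "\<sigma> 1 = 0" "\<sigma> 2 = 1" | "\<sigma> 0 = 2" "\<sigma> 1 = 1" "\<sigma> 2 = 0"
proof -
  have "\<sigma> 0 \<in> {..<3}" "\<sigma> 1 \<in> {..<3}" "\<sigma> 2 \<in> {..<3}"
    unfolding permutes_in_image[OF assms] by simp_all
  then have "\<sigma> 0 \<in> {0, 1, 2}" "\<sigma> 1 \<in> {0, 1, 2}" "\<sigma> 2 \<in> {0, 1, 2}"
    unfolding lessThan_3_nat .
  moreover have "\<sigma> 0 \<noteq> \<sigma> 1" "\<sigma> 1 \<noteq> \<sigma> 2" "\<sigma> 0 \<noteq> \<sigma> 2"
    using permutes_inj[OF assms] by (simp_all add: inj_eq)
  ultimately show thesis
    using that by auto
qed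

lemma permutation_invariants:
  assumes "\<sigma> permutes {..<3}"
  shows "perimeter (P \<circ> \<sigma>) = perimeter P" and "side_squares (P \<circ> \<sigma>) = side_squares P"
    and "double_area (P \<circ> \<sigma>) = double_area P"
proof -
  show "perimeter (P \<circ> \<sigma>) = perimeter P"
    using assms by (rule permutes_3_cases) (simp_all add: perimeter_def dist_commute)
  show "side_squares (P \<circ> \<sigma>) = side_squares P"
    using assms by (rule permutes_3_cases) (simp_all add: side_squares_def dist_commute)
  show "double_area (P \<circ> \<sigma>) = double_area P"
    using assms by (rule permutes_3_cases) (simp_all add: double_area_def algebra_simps abs_if)
qed

lemma optimal_assignment_iff_side_correlation:
  assumes "inj_on P {..<3}"
  shows "optimal_assignment R P \<longleftrightarrow>
    (\<forall>\<sigma>. \<sigma> permutes {..<3} \<longrightarrow> side_correlation R (P \<circ> \<sigma>) \<le> side_correlation R P)"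
proof -
  have "cost R P \<le> cost R (P \<circ> \<sigma>) \<longleftrightarrow> side_correlation R (P \<circ> \<sigma>) \<le> side_correlation R P"
    if "\<sigma> permutes {..<3}" for \<sigma>
  proof (rule cost_le_iff[OF assms])
    show "inj_on (P \<circ> \<sigma>) {..<3}"
      using assms permutes_inj_on[OF that] permutes_image[OF that] by (intro comp_inj_on) auto
  qed (simp_all add: permutation_invariants[OF that])
  then show ?thesis
    unfolding optimal_assignment_def by blast
qed

lemma rearrangement_two:
  fixes a b x y :: real
  assumes "a \<le> b" and "x \<le> y"
  shows "a * y + b * x \<le> a * x + b * y"
  using mult_nonneg_nonneg[of "b - a" "y - x"] assms by (simp add: algebra_simps)

text \<open>The sign of \<open>(b - a) * (y - x)\<close> decides; strictness of \<open>a < b\<close>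
  lets the order of \<open>x\<close> and \<open>y\<close> be recovered.\<close>

lemma rearrangement_two_strict:
  fixes a b x y :: real
  assumes "a < b" and "a * y + b * x \<le> a * x + b * y"
  shows "x \<le> y"
proof -
  have "0 \<le> (b - a) * (y - x)"
    using assms(2) by (simp add: algebra_simps)
  then show ?thesis
    using assms(1) by (simp add: zero_le_mult_iff)
qed

theorem theorem8:
  fixes R P :: "nat \<Rightarrow> complex"
  assumes "general_position R"
    and "inj_on P {..<3}"
    and "dist (R 0) (R 1) \<le> dist (R 1) (R 2)"
    and "dist (R 1) (R 2) \<le> dist (R 2) (R 0)"
  shows "optimal_assignment R P \<longleftrightarrow>
    dist (P 0) (P 1) \<le> dist (P 1) (P 2) \<and> dist (P 1) (P 2) \<le> dist (P 2) (P 0)"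
proof -
  define a b c where "a = (dist (R 0) (R 1))\<^sup>2" and "b = (dist (R 1) (R 2))\<^sup>2"
    and "c = (dist (R 2) (R 0))\<^sup>2"
  define x y z where "x = (dist (P 0) (P 1))\<^sup>2" and "y = (dist (P 1) (P 2))\<^sup>2"
    and "z = (dist (P 2) (P 0))\<^sup>2"
  note defs = a_def b_def c_def x_def y_def z_def
  have "dist (R 0) (R 1) < dist (R 1) (R 2)" "dist (R 1) (R 2) < dist (R 2) (R 0)"
    using assms(1,3,4) by (auto simp: general_position_def)
  then have "a < b" "b < c"
    unfolding defs by (auto intro: power_strict_mono)
  have "dist (P 0) (P 1) \<le> dist (P 1) (P 2) \<longleftrightarrow> x \<le> y"
    "dist (P 1) (P 2) \<le> dist (P 2) (P 0) \<longleftrightarrow> y \<le> z"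
    unfolding defs by (simp_all add: power_mono_iff)
  moreover have "optimal_assignment R P \<longleftrightarrow> x \<le> y \<and> y \<le> z"
    unfolding optimal_assignment_iff_side_correlation[OF assms(2)]
  proof (intro iffI conjI)
    assume opt: "\<forall>\<sigma>. \<sigma> permutes {..<3} \<longrightarrow> side_correlation R (P \<circ> \<sigma>) \<le> side_correlation R P"
    \<comment> \<open>Swapping indices 0 and 2 exchanges \<open>x\<close> and \<open>y\<close>;
      swapping 0 and 1 exchanges \<open>y\<close> and \<open>z\<close>. These two comparisons
      already force the order.\<close>
    have "Transposition.transpose 0 2 permutes {..<3::nat}" "Transposition.transpose 0 1 permutes {..<3::nat}"
      by (auto intro: permutes_swap_id)
    with opt have "side_correlation R (P \<circ> Transposition.transpose 0 2) \<le> side_correlation R P"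
      "side_correlation R (P \<circ> Transposition.transpose 0 1) \<le> side_correlation R P"
      by blast+
    then have "a * y + b * x \<le> a * x + b * y" "b * z + c * y \<le> b * y + c * z"
      by (simp_all add: side_correlation_def defs dist_commute Transposition.transpose_def)
    then show "x \<le> y" "y \<le> z"
      using rearrangement_two_strict \<open>a < b\<close> \<open>b < c\<close> by blast+
  next
    assume "x \<le> y \<and> y \<le> z"
    \<comment> \<open>The first three settle the transpositions. For each 3-cycle, one of the last
      two is added to the first.\<close>
    then have ineqs: "a * y + b * x \<le> a * x + b * y" "b * z + c * y \<le> b * y + c * z"
      "a * z + c * x \<le> a * x + c * z" "a * z + c * y \<le> a * y + c * z"
      "b * z + c * x \<le> b * x + c * z"
      using \<open>a < b\<close> \<open>b < c\<close> by (auto intro!: rearrangement_two)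
    show "\<forall>\<sigma>. \<sigma> permutes {..<3} \<longrightarrow> side_correlation R (P \<circ> \<sigma>) \<le> side_correlation R P"
    proof (intro allI impI)
      fix \<sigma> :: "nat \<Rightarrow> nat" assume "\<sigma> permutes {..<3}"
      then show "side_correlation R (P \<circ> \<sigma>) \<le> side_correlation R P"
        by (rule permutes_3_cases)
          (use ineqs in \<open>simp_all add: side_correlation_def defs dist_commute\<close>)
    qed
  qed
  ultimately show ?thesis by simp
qed

end
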